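(* Fix $0\le r<s$. Define $\phi^s_r:L^s_r\times\Omega^s_r\to\Lambda^s_r$ by $\phi^s_r(a,b,\omega)=\varphi^{s,b}_{r,a}(\omega)$ for $(a,b,\omega)\in L^s_r\times\Omega^s_r$. Then $\phi^s_r$ is continuous. In particular, for any $(a,b)\in L^s_r$, the function $\varphi^{s,b}_{r,a}:\Omega^s_r\to\Lambda^{s,b}_{r,a}$ is continuous.
   Context: Fix a constant $c>0$. For $0\le r<s$ and $a,b\in\mathbb{R}$ let $F_{r,a}=\{(t,x)\in\mathbb{R}^2: r\le t,\ a-c(t-r)\le x\le a+c(t-r)\}$, $B_{s,b}=\{(t,x)\in\mathbb{R}^2: t\le s,\ b-c(s-t)\le x\le b+c(s-t)\}$, and $P^{s,b}_{r,a}=F_{r,a}\cap B_{s,b}$ (nonempty if and only if $|b-a|\le c(s-r)$). When $P^{s,b}_{r,a}\ne\emptyset$ let $I^{s,b}_{r,a}=\{x\in\mathbb{R}:(\tfrac12(r+s),x)\in P^{s,b}_{r,a}\}$, a (possibly degenerate) closed interval. Let $L^s_r=\{(a,b)\in\mathbb{R}^2:|b-a|\le c(s-r)\}$. Standing assumption: for all such $r,s,a,b$ with $P^{s,b}_{r,a}\neq\emptyset$ we are given a continuous function $\lambda^{s,b}_{r,a}:[0,1]\to I^{s,b}_{r,a}$ mapping $[0,1]$ onto $I^{s,b}_{r,a}$, such that $(a,b,r,s,\xi)\mapsto\lambda^{s,b}_{r,a}(\xi)$ is continuous on $D_\lambda=\{(a,b,r,s,\xi)\in\mathbb{R}^5: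 0\le r<s,\ |b-a|\le c(s-r),\ \xi\in[0,1]\}$. Let $t_{nj}=r+\frac{j}{2^n}(s-r)$ for $0\le j\le 2^n$, $n\ge 0$; $V^s_{r,n}=\{t_{nj}:0<j<2^n\}$ for $n\ge1$; $V^s_r=\bigcup_{n\ge1}V^s_{r,n}$; $\Omega^s_r=[0,1]^{V^s_r}$, with the product topology. Let $C^s_r$ be the space of continuous $x:[r,s]\to\mathbb{R}$ with the uniform (sup-norm) topology, $\Lambda^s_r=\{x\in C^s_r:|x(v)-x(u)|\le c|v-u|\text{ for all }u,v\in[r,s]\}$, and $\Lambda^{s,b}_{r,a}=\{x\in\Lambda^s_r: x(r)=a,\ x(s)=b\}$, both with the subspace topology. Definition of $\varphi^{s,b}_{r,a}$ (when $P^{s,b}_{r,a}\neq\emptyset$): for $\omega\in\Omega^s_r$, the function $\varphi(\omega)=\varphi^{s,b}_{r,a}(\omega)$ is defined on $V^s_r\cup\{r,s\}$ recursively by $\varphi(\omega)(r)=a$, $\varphi(\omega)(s)=b$, and, for $m\ge1$ and $1\le j\le 2^{m-1}$, writing $a_{m-1,i}=\varphi(\omega)(t_{m-1,i})$, $$\varphi(\omega)(t_{m,2j-1})=\lambda^{t_{m-1,j},a_{m-1,j}}_{t_{m-1,j-1},a_{m-1,j-1}}(\omega_{t_{m,2j-1}})$$ (at each step the relevant set $P^{t_{m-1,j},a_{m-1,j}}_{t_{m-1,j-1},a_{m-1,j-1}}$ is nonempty, and $t_{m,2j}=t_{m-1,j}$). The resulting function is $c$-Lipschitz on the dense set $V^s_r\cup\{r,s\}$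 and $\varphi^{s,b}_{r,a}(\omega)\in\Lambda^{s,b}_{r,a}$ denotes its unique continuous extension to $[r,s]$. *)

theory Defs
  imports "HOL-Analysis.Analysis"
begin

section \<open>Cones and causal diamonds\<close>

text \<open>Points of the plane are pairs \<open>(t, x)\<close>, time first. The speed \<open>c\<close> is an explicit parameter.\<close>

definition fwd_cone :: "real \<Rightarrow> real \<Rightarrow> real \<Rightarrow> (real \<times> real) set" where
  "fwd_cone c r a = {(t, x). r \<le> t \<and> a - c * (t - r) \<le> x \<and> x \<le> a + c * (t - r)}"

definition bwd_cone :: "real \<Rightarrow> real \<Rightarrow> real \<Rightarrow> (real \<times> real) set" where
  "bwd_cone c s b = {(t, x). t \<le> s \<and> b - c * (s - t) \<le> x \<and> x \<le> b + c * (s - t)}"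

definition diamond :: "real \<Rightarrow> real \<Rightarrow> real \<Rightarrow> real \<Rightarrow> real \<Rightarrow> (real \<times> real) set" where
  "diamond c r a s b = fwd_cone c r a \<inter> bwd_cone c s b"

definition mid_slice :: "real \<Rightarrow> real \<Rightarrow> real \<Rightarrow> real \<Rightarrow> real \<Rightarrow> real set" where
  "mid_slice c r a s b = {x. ((r + s) / 2, x) \<in> diamond c r a s b}"

definition endpoint_pairs :: "real \<Rightarrow> real \<Rightarrow> real \<Rightarrow> (real \<times> real) set" where
  "endpoint_pairs c r s = {(a, b). \<bar>b - a\<bar> \<le> c * (s - r)}"

section \<open>The given family of midpoint maps\<close>

text \<open>The map with lower indices \<open>r, a\<close> and upper indices \<open>s, b\<close> is \<open>l r a s b\<close>.
  It is a total function in HOL; its values off \<open>lambda_dom c\<close> are unconstrained.\<close>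

definition lambda_dom :: "real \<Rightarrow> (real \<times> real \<times> real \<times> real \<times> real) set" where
  "lambda_dom c = {(a, b, r, s, \<xi>). 0 \<le> r \<and> r < s \<and> \<bar>b - a\<bar> \<le> c * (s - r) \<and> \<xi> \<in> {0..1}}"

definition lambda_family ::
    "real \<Rightarrow> (real \<Rightarrow> real \<Rightarrow> real \<Rightarrow> real \<Rightarrow> real \<Rightarrow> real) \<Rightarrow> bool" where
  "lambda_family c l \<longleftrightarrow>
     (\<forall>r a s b. 0 \<le> r \<longrightarrow> r < s \<longrightarrow> diamond c r a s b \<noteq> {} \<longrightarrow>
        continuous_on {0..1} (l r a s b) \<and> l r a s b ` {0..1} = mid_slice c r a s b) \<and>
     continuous_on (lambda_dom c) (\<lambda>(a, b, r, s, \<xi>). l r a s b \<xi>)"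

section \<open>Dyadic points and the parameter space\<close>

definition dyadic_pt :: "real \<Rightarrow> real \<Rightarrow> nat \<Rightarrow> nat \<Rightarrow> real" where
  "dyadic_pt r s n j = r + real j / 2 ^ n * (s - r)"

definition dyadic_level :: "real \<Rightarrow> real \<Rightarrow> nat \<Rightarrow> real set" where
  "dyadic_level r s n = {dyadic_pt r s n j |j. 0 < j \<and> j < 2 ^ n}"

definition dyadics :: "real \<Rightarrow> real \<Rightarrow> real set" where
  "dyadics r s = (\<Union>n\<in>{1..}. dyadic_level r s n)"

text \<open>Elements of this space are functions on \<open>dyadics r s\<close>, extended by \<open>undefined\<close>
  elsewhere, with values in \<open>{0..1}\<close>.\<close>

definition param_topology :: "real \<Rightarrow> real \<Rightarrow> (real \<Rightarrow> real) topology" where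
  "param_topology r s = product_topology (\<lambda>_. top_of_set {0..1}) (dyadics r s)"

section \<open>Path spaces\<close>

text \<open>Continuous functions on \<open>{r..s}\<close> (extended by \<open>undefined\<close> elsewhere) with the sup metric.
  The boundedness built into \<^const>\<open>cfunspace\<close> is automatic, since \<open>{r..s}\<close> is compact.\<close>

definition path_metric :: "real \<Rightarrow> real \<Rightarrow> (real \<Rightarrow> real) metric" where
  "path_metric r s = cfunspace (top_of_set {r..s}) euclidean_metric"

abbreviation path_topology :: "real \<Rightarrow> real \<Rightarrow> (real \<Rightarrow> real) topology" where
  "path_topology r s \<equiv> mtopology_of (path_metric r s)"

definition lip_paths :: "real \<Rightarrow> real \<Rightarrow> real \<Rightarrow> (real \<Rightarrow> real) set" where
  "lip_paths c r s =
     {x \<in> mspace (path_metric r s). \<forall>u\<in>{r..s}. \<forall>v\<in>{r..s}. \<bar>x v - x u\<bar> \<le> c * \<bar>v - u\<bar>}"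

definition lip_bridges :: "real \<Rightarrow> real \<Rightarrow> real \<Rightarrow> real \<Rightarrow> real \<Rightarrow> (real \<Rightarrow> real) set" where
  "lip_bridges c r a s b = {x \<in> lip_paths c r s. x r = a \<and> x s = b}"

section \<open>The path determined by a parameter\<close>

text \<open>\<open>grid_val l r a s b \<omega> m j\<close> is the value at \<open>dyadic_pt r s m j\<close>, for \<open>j \<le> 2 ^ m\<close>.
  At level \<open>Suc m\<close>, an even index \<open>2 * i\<close> denotes the level \<open>m\<close> point with index \<open>i\<close>, and an
  odd index \<open>2 * i + 1\<close> denotes the midpoint of the level \<open>m\<close> points with indices
  \<open>i\<close> and \<open>i + 1\<close>.\<close>

fun grid_val :: "(real \<Rightarrow> real \<Rightarrow> real \<Rightarrow> real \<Rightarrow> real \<Rightarrow> real) \<Rightarrow>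
    real \<Rightarrow> real \<Rightarrow> real \<Rightarrow> real \<Rightarrow> (real \<Rightarrow> real) \<Rightarrow> nat \<Rightarrow> nat \<Rightarrow> real" where
  "grid_val l r a s b \<omega> 0 j = (if j = 0 then a else b)"
| "grid_val l r a s b \<omega> (Suc m) j =
     (let i = j div 2 in
      if even j then grid_val l r a s b \<omega> m i
      else l (dyadic_pt r s m i) (grid_val l r a s b \<omega> m i)
             (dyadic_pt r s m (Suc i)) (grid_val l r a s b \<omega> m (Suc i))
             (\<omega> (dyadic_pt r s (Suc m) j)))"

text \<open>The unique continuous function on \<open>{r..s}\<close> with the prescribed values on all dyadic
  points, including the endpoints \<open>r\<close> (index \<open>0\<close>) and \<open>s\<close> (index \<open>2 ^ m\<close>).\<close>

definition bridge :: "(real \<Rightarrow> real \<Rightarrow> real \<Rightarrow> real \<Rightarrow> real \<Rightarrow> real) \<Rightarrow>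
    real \<Rightarrow> real \<Rightarrow> real \<Rightarrow> real \<Rightarrow> (real \<Rightarrow> real) \<Rightarrow> (real \<Rightarrow> real)" where
  "bridge l r a s b \<omega> =
     (THE x. x \<in> mspace (path_metric r s) \<and>
        (\<forall>m. \<forall>j\<le>2 ^ m. x (dyadic_pt r s m j) = grid_val l r a s b \<omega> m j))"

definition bridge_joint :: "(real \<Rightarrow> real \<Rightarrow> real \<Rightarrow> real \<Rightarrow> real \<Rightarrow> real) \<Rightarrow>
    real \<Rightarrow> real \<Rightarrow> (real \<times> real) \<times> (real \<Rightarrow> real) \<Rightarrow> (real \<Rightarrow> real)" where
  "bridge_joint l r s = (\<lambda>((a, b), \<omega>). bridge l r a s b \<omega>)"

end

theory Submission
  imports Defs
begin

text \<open>
  The reason for continuity is that the paths are equi-Lipschitz, so that the uniform topology on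
  them is already controlled by finitely many coordinates. Two \<open>c\<close>-Lipschitz paths that differ by at
  most \<open>e\<close> on the level \<open>m\<close> grid differ by at most \<open>e + 2 * c * (s - r) / 2 ^ m\<close> everywhere
  (\<open>dist_le_from_grid\<close>), and the last term does not depend on the paths. Hence it is enough that each
  single grid value is continuous in \<open>((a, b), \<omega>)\<close>. This holds by induction on the level
  (\<open>continuous_map_grid_val\<close>): a new value arises by applying the jointly continuous midpoint family to
  two values of the previous level and to one coordinate of \<open>\<omega>\<close>.

  Both parts of the argument rest on the invariant that neighbouring grid values at distance \<open>h\<close> in
  time differ by at most \<open>c * h\<close> (\<open>grid_val_step\<close>). It keeps the recursion inside the domain on which
  the midpoint family is known to be continuous, and it yields a Lipschitz bound between any two
  dyadic points, whence the interpolating path exists by Lipschitz extension and is unique by density.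
\<close>

section \<open>Dyadic grids\<close>

lemma dyadic_pt_double: "dyadic_pt r s (Suc m) (2 * i) = dyadic_pt r s m i"
  by (simp add: dyadic_pt_def)

lemma dyadic_pt_midpoint:
  "dyadic_pt r s (Suc m) (Suc (2 * i)) = (dyadic_pt r s m i + dyadic_pt r s m (Suc i)) / 2"
  by (simp add: dyadic_pt_def field_simps)

lemma dyadic_pt_lift: "dyadic_pt r s (m + k) (2 ^ k * j) = dyadic_pt r s m j"
  by (simp add: dyadic_pt_def power_add)

lemma dyadic_pt_less_Suc: "r < s \<Longrightarrow> dyadic_pt r s m j < dyadic_pt r s m (Suc j)"
  by (simp add: dyadic_pt_def divide_strict_right_mono)

lemma dyadic_pt_ge: "r < s \<Longrightarrow> r \<le> dyadic_pt r s m j"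
  by (simp add: dyadic_pt_def)

lemma dyadic_pt_in_interval:
  assumes "r < s" "j \<le> 2 ^ m"
  shows "dyadic_pt r s m j \<in> {r..s}"
proof -
  have "real j \<le> 2 ^ m"
    using assms(2) by (metis of_nat_le_iff of_nat_numeral of_nat_power)
  then have "real j / 2 ^ m * (s - r) \<le> 1 * (s - r)"
    using assms(1) by (intro mult_right_mono) auto
  then show ?thesis
    using assms(1) by (simp add: dyadic_pt_def)
qed

lemma dyadic_pt_in_dyadics:
  assumes "0 < j" "j < 2 ^ Suc m"
  shows "dyadic_pt r s (Suc m) j \<in> dyadics r s"
  using assms unfolding dyadics_def dyadic_level_def by force

lemma dyadic_pt_near:
  assumes "r < s" "t \<in> {r..s}"
  obtains j where "j \<le> 2 ^ m" "\<bar>t - dyadic_pt r s m j\<bar> \<le> (s - r) / 2 ^ m"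
proof -
  define z where "z = (t - r) / (s - r) * 2 ^ m"
  define j where "j = nat \<lfloor>z\<rfloor>"
  have t: "t = r + z / 2 ^ m * (s - r)"
    using assms by (simp add: z_def)
  have z0: "0 \<le> z"
    using assms by (simp add: z_def)
  have "(t - r) / (s - r) * 2 ^ m \<le> 1 * 2 ^ m"
    using assms by (intro mult_right_mono) auto
  then have z1: "z \<le> 2 ^ m"
    by (simp add: z_def)
  have j: "real j \<le> z" "z \<le> real j + 1"
    using z0 by (simp_all add: j_def)
  have "real j \<le> 2 ^ m"
    using j(1) z1 by linarith
  then have "j \<le> 2 ^ m"
    by (metis of_nat_le_iff of_nat_numeral of_nat_power)
  moreover have "t - dyadic_pt r s m j = (z - real j) / 2 ^ m * (s - r)"
    by (simp add: t dyadic_pt_def field_simps)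
  moreover have "0 \<le> (z - real j) / 2 ^ m * (s - r)"
    using j assms by simp
  moreover have "(z - real j) / 2 ^ m * (s - r) \<le> 1 / 2 ^ m * (s - r)"
    using j assms by (intro mult_right_mono divide_right_mono) auto
  ultimately show thesis
    using that by auto
qed

section \<open>Lipschitz paths\<close>

text \<open>This is McShane's formula for extending Lipschitz functions. Indexing the data by an arbitrary
  set spares the proof that the value at a point is independent of the level at which it is named.\<close>

lemma Lipschitz_interpolation:
  fixes p v :: "'i \<Rightarrow> real"
  assumes c: "0 \<le> c"
    and lip: "\<And>i j. i \<in> I \<Longrightarrow> j \<in> I \<Longrightarrow> \<bar>v i - v j\<bar> \<le> c * \<bar>p i - p j\<bar>"
  obtains f :: "real \<Rightarrow> real"
  where "\<And>i. i \<in> I \<Longrightarrow> f (p i) = v i" "\<And>t u. \<bar>f t - f u\<bar> \<le> c * \<bar>t - u\<bar>"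
proof (cases "I = {}")
  case True
  then show thesis
    using that[of "\<lambda>_. 0"] c by simp
next
  case False
  then obtain k where k: "k \<in> I" by blast
  define f where "f t = (INF i\<in>I. v i + c * \<bar>t - p i\<bar>)" for t
  have tri: "c * \<bar>x - z\<bar> \<le> c * \<bar>x - y\<bar> + c * \<bar>y - z\<bar>" for x y z
    unfolding distrib_left[symmetric] using c by (intro mult_left_mono) auto
  have bdd: "bdd_below ((\<lambda>i. v i + c * \<bar>t - p i\<bar>) ` I)" for t
  proof (rule bdd_belowI2)
    show "v k - c * \<bar>p k - t\<bar> \<le> v i + c * \<bar>t - p i\<bar>" if "i \<in> I" for i
      using lip[OF k that] tri[of "p k" "p i" t] by linarith
  qed
  have one: "f t \<le> f u + c * \<bar>t - u\<bar>" for t u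
  proof -
    have "f t - c * \<bar>t - u\<bar> \<le> v i + c * \<bar>u - p i\<bar>" if "i \<in> I" for i
      using cINF_lower[OF bdd[of t] that] tri[of t "p i" u] unfolding f_def by linarith
    then have "f t - c * \<bar>t - u\<bar> \<le> f u"
      unfolding f_def[of u] by (intro cINF_greatest) (use False in auto)
    then show ?thesis by simp
  qed
  show thesis
  proof
    show "\<bar>f t - f u\<bar> \<le> c * \<bar>t - u\<bar>" for t u
      using one[of t u] one[of u t] by (simp add: abs_minus_commute abs_le_iff)
    show "f (p i) = v i" if "i \<in> I" for i
    proof (rule antisym)
      show "f (p i) \<le> v i"
        using cINF_lower[OF bdd[of "p i"] that] by (simp add: f_def)
      have "v i \<le> v j + c * \<bar>p i - p j\<bar>" if "j \<in> I" for j
        using lip[OF \<open>i \<in> I\<close> that] by linarith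
      then show "v i \<le> f (p i)"
        unfolding f_def by (intro cINF_greatest) (use False in auto)
    qed
  qed
qed

lemma in_path_space_iff:
  "x \<in> mspace (path_metric r s) \<longleftrightarrow> x \<in> extensional {r..s} \<and> continuous_on {r..s} x"
proof -
  have "bounded (x ` {r..s})" if "continuous_on {r..s} x"
    using that compact_continuous_image compact_imp_bounded by blast
  then show ?thesis
    by (auto simp: path_metric_def Metric_space.fspace_def)
qed

lemma path_eqI_dyadic:
  assumes rs: "r < s" and x: "x \<in> mspace (path_metric r s)" and y: "y \<in> mspace (path_metric r s)"
    and eq: "\<And>m j. j \<le> 2 ^ m \<Longrightarrow> x (dyadic_pt r s m j) = y (dyadic_pt r s m j)"
  shows "x = y"
proof (rule extensionalityI)
  show "x \<in> extensional {r..s}" "y \<in> extensional {r..s}"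
    using x y by (auto simp: in_path_space_iff)
  fix t assume t: "t \<in> {r..s}"
  have "\<exists>j. j \<le> 2 ^ m \<and> \<bar>t - dyadic_pt r s m j\<bar> \<le> (s - r) / 2 ^ m" for m
    using dyadic_pt_near[OF rs t] by metis
  then obtain J where J: "\<And>m. J m \<le> 2 ^ m"
      "\<And>m. \<bar>t - dyadic_pt r s m (J m)\<bar> \<le> (s - r) / 2 ^ m"
    by metis
  have "(\<lambda>m. (s - r) * (1 / 2) ^ m) \<longlonglongrightarrow> (s - r) * 0"
    by (intro tendsto_intros LIMSEQ_realpow_zero) auto
  then have "(\<lambda>m. (s - r) / 2 ^ m) \<longlonglongrightarrow> 0"
    by (simp add: power_divide)
  then have lim: "(\<lambda>m. dyadic_pt r s m (J m)) \<longlonglongrightarrow> t"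
    unfolding tendsto_dist_iff[of _ t]
    by (rule Lim_null_comparison[rotated])
      (use J(2) in \<open>auto simp: dist_real_def abs_minus_commute\<close>)
  have *: "(\<lambda>m. z (dyadic_pt r s m (J m))) \<longlonglongrightarrow> z t" if "continuous_on {r..s} z"
    for z :: "real \<Rightarrow> real"
    by (rule continuous_on_tendsto_compose[OF that lim t])
      (use dyadic_pt_in_interval[OF rs J(1)] in auto)
  show "x t = y t"
    using LIMSEQ_unique *[of x] *[of y] x y eq[OF J(1)] by (auto simp: in_path_space_iff)
qed

text \<open>Equi-Lipschitz paths are compared through a grid point within \<open>(s - r) / 2 ^ m\<close> of the given
  time. Moving there costs each of the two paths at most \<open>c * (s - r) / 2 ^ m\<close>.\<close>

lemma dist_le_from_grid:
  assumes rs: "r < s" and c: "0 \<le> c" and e: "0 \<le> e"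
    and x: "x \<in> lip_paths c r s" and y: "y \<in> lip_paths c r s"
    and grid: "\<And>j. j \<le> 2 ^ m \<Longrightarrow> \<bar>x (dyadic_pt r s m j) - y (dyadic_pt r s m j)\<bar> \<le> e"
  shows "mdist (path_metric r s) x y \<le> e + 2 * (c * ((s - r) / 2 ^ m))"
  unfolding path_metric_def
proof (rule mdist_cfunspace_le)
  show "0 \<le> e + 2 * (c * ((s - r) / 2 ^ m))"
    using assms by simp
  fix t assume "t \<in> topspace (top_of_set {r..s})"
  then have t: "t \<in> {r..s}" by simp
  obtain j where j: "j \<le> 2 ^ m" "\<bar>t - dyadic_pt r s m j\<bar> \<le> (s - r) / 2 ^ m"
    by (rule dyadic_pt_near[OF rs t])
  let ?d = "dyadic_pt r s m j"
  have d: "?d \<in> {r..s}"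
    by (rule dyadic_pt_in_interval[OF rs j(1)])
  have cost: "c * \<bar>t - ?d\<bar> \<le> c * ((s - r) / 2 ^ m)"
    using j(2) c by (rule mult_left_mono)
  have "\<bar>x t - x ?d\<bar> \<le> c * \<bar>t - ?d\<bar>" "\<bar>y t - y ?d\<bar> \<le> c * \<bar>t - ?d\<bar>"
    using x y t d by (auto simp: lip_paths_def)
  with cost grid[OF j(1)] show "mdist euclidean_metric (x t) (y t) \<le> e + 2 * (c * ((s - r) / 2 ^ m))"
    by (simp add: dist_real_def)
qed

section \<open>Grid values\<close>

lemma mid_slice_iff:
  "r < s \<Longrightarrow> x \<in> mid_slice c r a s b \<longleftrightarrow>
     \<bar>x - a\<bar> \<le> c * ((s - r) / 2) \<and> \<bar>b - x\<bar> \<le> c * ((s - r) / 2)"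
proof -
  assume rs: "r < s"
  define h where "h = c * ((s - r) / 2)"
  have mid: "(r + s) / 2 - r = (s - r) / 2" "s - (r + s) / 2 = (s - r) / 2"
    by (simp_all add: field_simps)
  show ?thesis
    using rs
    unfolding mid_slice_def diamond_def fwd_cone_def bwd_cone_def mem_Collect_eq Int_iff prod.case mid
      h_def[symmetric]
    by auto
qed

lemma lambda_family_midpoint:
  assumes "lambda_family c l" "0 \<le> r" "r < s" "\<bar>b - a\<bar> \<le> c * (s - r)" "\<xi> \<in> {0..1}"
  shows "\<bar>l r a s b \<xi> - a\<bar> \<le> c * ((s - r) / 2)" "\<bar>b - l r a s b \<xi>\<bar> \<le> c * ((s - r) / 2)"
proof -
  have "(r, a) \<in> diamond c r a s b"
    using assms(3,4) by (auto simp: diamond_def fwd_cone_def bwd_cone_def)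
  then have "l r a s b ` {0..1} = mid_slice c r a s b"
    using assms(1-3) unfolding lambda_family_def by blast
  then have "l r a s b \<xi> \<in> mid_slice c r a s b"
    using assms(5) by blast
  then show "\<bar>l r a s b \<xi> - a\<bar> \<le> c * ((s - r) / 2)" "\<bar>b - l r a s b \<xi>\<bar> \<le> c * ((s - r) / 2)"
    using mid_slice_iff[OF assms(3)] by auto
qed

lemma grid_val_odd:
  "grid_val l r a s b \<omega> (Suc m) (Suc (2 * i)) =
     l (dyadic_pt r s m i) (grid_val l r a s b \<omega> m i)
       (dyadic_pt r s m (Suc i)) (grid_val l r a s b \<omega> m (Suc i))
       (\<omega> (dyadic_pt r s (Suc m) (Suc (2 * i))))"
  by (simp add: Let_def)

lemma grid_val_lift: "grid_val l r a s b \<omega> (m + k) (2 ^ k * j) = grid_val l r a s b \<omega> m j"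
  by (induction k) (simp_all add: Let_def)

locale bridge_family =
  fixes c r s :: real and l :: "real \<Rightarrow> real \<Rightarrow> real \<Rightarrow> real \<Rightarrow> real \<Rightarrow> real"
  assumes c_pos: "0 < c" and family: "lambda_family c l" and r_nonneg: "0 \<le> r" and r_less_s: "r < s"
begin

text \<open>The midpoint inserted between two neighbours lies in the mid-time slice of their diamond, that
  is, within half of the allowed displacement of each of them. So the bound passes to the next level,
  and with it the diamonds of the next level are nonempty.\<close>

lemma grid_val_step:
  assumes ab: "(a, b) \<in> endpoint_pairs c r s" and \<omega>: "\<omega> \<in> topspace (param_topology r s)"
  shows "j < 2 ^ m \<Longrightarrow> \<bar>grid_val l r a s b \<omega> m (Suc j) - grid_val l r a s b \<omega> m j\<bar>
           \<le> c * (dyadic_pt r s m (Suc j) - dyadic_pt r s m j)"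
proof (induction m arbitrary: j)
  case 0
  then show ?case
    using ab by (simp add: endpoint_pairs_def dyadic_pt_def)
next
  case (Suc m)
  define i where "i = j div 2"
  have i: "i < 2 ^ m"
    using Suc.prems by (simp add: i_def)
  let ?t = "dyadic_pt r s m i" and ?u = "dyadic_pt r s m (Suc i)"
  have "dyadic_pt r s (Suc m) (Suc (2 * i)) \<in> dyadics r s"
    using i by (intro dyadic_pt_in_dyadics) auto
  then have \<xi>: "\<omega> (dyadic_pt r s (Suc m) (Suc (2 * i))) \<in> {0..1}"
    using \<omega> by (auto simp: param_topology_def PiE_iff)
  note mid = lambda_family_midpoint[OF family order_trans[OF r_nonneg dyadic_pt_ge[OF r_less_s]]
      dyadic_pt_less_Suc[OF r_less_s] Suc.IH[OF i] \<xi>, unfolded dyadic_pt_midpoint]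
  have half: "(?t + ?u) / 2 - ?t = (?u - ?t) / 2" "?u - (?t + ?u) / 2 = (?u - ?t) / 2"
    by (simp_all add: field_simps)
  have right: "grid_val l r a s b \<omega> (Suc m) (2 * Suc i) = grid_val l r a s b \<omega> m (Suc i)"
    and left: "grid_val l r a s b \<omega> (Suc m) (2 * i) = grid_val l r a s b \<omega> m i"
    by (simp_all add: Let_def)
  show ?case
  proof (cases "even j")
    case True
    then have j: "j = 2 * i" by (simp add: i_def)
    show ?thesis
      unfolding j grid_val_odd left dyadic_pt_midpoint dyadic_pt_double half by (rule mid(1))
  next
    case False
    then have j: "j = Suc (2 * i)" and Sj: "Suc (Suc (2 * i)) = 2 * Suc i"
      by (simp_all add: i_def)
    show ?thesis
      unfolding j Sj grid_val_odd right dyadic_pt_midpoint dyadic_pt_double half by (rule mid(2))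
  qed
qed

lemma grid_val_Lipschitz_same_level:
  assumes ab: "(a, b) \<in> endpoint_pairs c r s" and \<omega>: "\<omega> \<in> topspace (param_topology r s)"
    and "i \<le> j" "j \<le> 2 ^ m"
  shows "\<bar>grid_val l r a s b \<omega> m j - grid_val l r a s b \<omega> m i\<bar>
           \<le> c * (dyadic_pt r s m j - dyadic_pt r s m i)"
  using assms(3,4)
proof (induction j rule: dec_induct)
  case base
  then show ?case by simp
next
  case (step n)
  have "\<bar>grid_val l r a s b \<omega> m (Suc n) - grid_val l r a s b \<omega> m n\<bar>
          \<le> c * (dyadic_pt r s m (Suc n) - dyadic_pt r s m n)"
    using step.prems by (intro grid_val_step[OF ab \<omega>]) simp
  with step.IH step.prems show ?case
    unfolding right_diff_distrib by linarith
qed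

lemma grid_val_Lipschitz:
  assumes ab: "(a, b) \<in> endpoint_pairs c r s" and \<omega>: "\<omega> \<in> topspace (param_topology r s)"
    and i: "i \<le> 2 ^ m" and j: "j \<le> 2 ^ n"
  shows "\<bar>grid_val l r a s b \<omega> m i - grid_val l r a s b \<omega> n j\<bar>
           \<le> c * \<bar>dyadic_pt r s m i - dyadic_pt r s n j\<bar>"
proof -
  \<comment> \<open>Step bounds add up only within one level, so both points are renamed at level \<open>m + n\<close>.\<close>
  define i' j' where "i' = 2 ^ n * i" and "j' = 2 ^ m * j"
  have le: "i' \<le> 2 ^ (m + n)" "j' \<le> 2 ^ (m + n)"
    using i j by (simp_all add: i'_def j'_def power_add mult.commute)
  have vals: "grid_val l r a s b \<omega> m i = grid_val l r a s b \<omega> (m + n) i'"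
      "grid_val l r a s b \<omega> n j = grid_val l r a s b \<omega> (m + n) j'"
    using grid_val_lift[of l r a s b \<omega> m n i] grid_val_lift[of l r a s b \<omega> n m j]
    by (simp_all add: i'_def j'_def add.commute)
  have pts: "dyadic_pt r s m i = dyadic_pt r s (m + n) i'"
      "dyadic_pt r s n j = dyadic_pt r s (m + n) j'"
    using dyadic_pt_lift[of r s m n i] dyadic_pt_lift[of r s n m j]
    by (simp_all add: i'_def j'_def add.commute)
  have *: "c * x \<le> c * \<bar>x\<bar>" "c * x \<le> c * \<bar>- x\<bar>" for x
    using c_pos by (auto intro: mult_left_mono)
  show ?thesis
    unfolding vals pts
  proof (cases "i' \<le> j'")
    case True
    show "\<bar>grid_val l r a s b \<omega> (m + n) i' - grid_val l r a s b \<omega> (m + n) j'\<bar>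
        \<le> c * \<bar>dyadic_pt r s (m + n) i' - dyadic_pt r s (m + n) j'\<bar>"
      using grid_val_Lipschitz_same_level[OF ab \<omega> True le(2)]
        *(2)[of "dyadic_pt r s (m + n) j' - dyadic_pt r s (m + n) i'"]
      by (simp add: abs_minus_commute)
  next
    case False
    then have "j' \<le> i'" by simp
    from grid_val_Lipschitz_same_level[OF ab \<omega> this le(1)] *(1)
    show "\<bar>grid_val l r a s b \<omega> (m + n) i' - grid_val l r a s b \<omega> (m + n) j'\<bar>
        \<le> c * \<bar>dyadic_pt r s (m + n) i' - dyadic_pt r s (m + n) j'\<bar>"
      by (rule order_trans)
  qed
qed

section \<open>The path determined by a parameter\<close>

lemma bridge_properties:
  assumes ab: "(a, b) \<in> endpoint_pairs c r s" and \<omega>: "\<omega> \<in> topspace (param_topology r s)"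
  shows bridge_in_lip_paths: "bridge l r a s b \<omega> \<in> lip_paths c r s"
    and bridge_dyadic_pt: "j \<le> 2 ^ m \<Longrightarrow>
      bridge l r a s b \<omega> (dyadic_pt r s m j) = grid_val l r a s b \<omega> m j"
proof -
  obtain f where f: "\<And>i. i \<in> {(m, j). j \<le> 2 ^ m} \<Longrightarrow>
        f (case_prod (dyadic_pt r s) i) = case_prod (grid_val l r a s b \<omega>) i"
      and lip: "\<And>t u. \<bar>f t - f u\<bar> \<le> c * \<bar>t - u\<bar>"
  proof (rule Lipschitz_interpolation[of c "{(m, j). j \<le> 2 ^ m}"
        "case_prod (grid_val l r a s b \<omega>)" "case_prod (dyadic_pt r s)"])
    show "0 \<le> c" using c_pos by simp
  qed (use grid_val_Lipschitz[OF ab \<omega>] in \<open>auto split: prod.splits\<close>)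
  have "c-lipschitz_on {r..s} f"
    using lip c_pos by (intro lipschitz_onI) (auto simp: dist_real_def)
  then have cont: "continuous_on {r..s} f"
    by (rule lipschitz_on_continuous_on)
  define x where "x = restrict f {r..s}"
  have x: "x \<in> mspace (path_metric r s)"
    using cont continuous_on_cong[of "{r..s}" "{r..s}" x f] by (simp add: in_path_space_iff x_def)
  have grid: "x (dyadic_pt r s m j) = grid_val l r a s b \<omega> m j" if "j \<le> 2 ^ m" for m j
    using f[of "(m, j)"] that dyadic_pt_in_interval[OF r_less_s that] by (simp add: x_def)
  have "bridge l r a s b \<omega> = x"
    unfolding bridge_def
  proof (rule the_equality)
    fix y assume "y \<in> mspace (path_metric r s) \<and>
      (\<forall>m. \<forall>j\<le>2 ^ m. y (dyadic_pt r s m j) = grid_val l r a s b \<omega> m j)"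
    then show "y = x"
      using grid x by (intro path_eqI_dyadic[OF r_less_s]) auto
  qed (use x grid in auto)
  then show "bridge l r a s b \<omega> \<in> lip_paths c r s"
    "j \<le> 2 ^ m \<Longrightarrow> bridge l r a s b \<omega> (dyadic_pt r s m j) = grid_val l r a s b \<omega> m j"
    using x grid lip by (auto simp: lip_paths_def x_def)
qed

lemma bridge_in_lip_bridges:
  assumes ab: "(a, b) \<in> endpoint_pairs c r s" and \<omega>: "\<omega> \<in> topspace (param_topology r s)"
  shows "bridge l r a s b \<omega> \<in> lip_bridges c r a s b"
  using bridge_in_lip_paths[OF ab \<omega>] bridge_dyadic_pt[OF ab \<omega>, of 0 0]
    bridge_dyadic_pt[OF ab \<omega>, of 1 0]
  by (simp add: lip_bridges_def dyadic_pt_def)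

section \<open>Continuity\<close>

abbreviation data_topology :: "((real \<times> real) \<times> (real \<Rightarrow> real)) topology" where
  "data_topology \<equiv> prod_topology (top_of_set (endpoint_pairs c r s)) (param_topology r s)"

lemma topspace_data:
  "p \<in> topspace data_topology \<Longrightarrow>
     (fst (fst p), snd (fst p)) \<in> endpoint_pairs c r s \<and> snd p \<in> topspace (param_topology r s)"
  by auto

lemma continuous_map_grid_val:
  "j \<le> 2 ^ m \<Longrightarrow> continuous_map data_topology euclideanreal
     (\<lambda>p. grid_val l r (fst (fst p)) s (snd (fst p)) (snd p) m j)"
proof (induction m arbitrary: j)
  case 0
  have "continuous_map data_topology euclidean fst"
    using continuous_map_fst continuous_map_into_fulltopology by blast
  then have "continuous_map data_topology euclideanreal (fst \<circ> fst)"
    "continuous_map data_topology euclideanreal (snd \<circ> fst)"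
    by (auto intro!: continuous_map_compose simp: continuous_on_fst continuous_on_snd)
  then show ?case
    by (cases "j = 0") (simp_all add: o_def)
next
  case (Suc m)
  define i where "i = j div 2"
  show ?case
  proof (cases "even j")
    case True
    then have "i \<le> 2 ^ m"
      using Suc.prems by (auto simp: i_def)
    with True Suc.IH[of i] show ?thesis
      by (simp add: i_def Let_def)
  next
    case False
    then have j: "j = Suc (2 * i)" by (simp add: i_def)
    then have i: "i < 2 ^ m" "Suc i \<le> 2 ^ m"
      using Suc.prems by simp_all
    let ?d = "dyadic_pt r s (Suc m) (Suc (2 * i))"
    let ?g = "\<lambda>p. grid_val l r (fst (fst p)) s (snd (fst p)) (snd p) m"
    let ?q = "\<lambda>p. (?g p i, ?g p (Suc i), dyadic_pt r s m i, dyadic_pt r s m (Suc i), snd p ?d)"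
    have d: "?d \<in> dyadics r s"
      using i by (intro dyadic_pt_in_dyadics) auto
    then have "continuous_map (param_topology r s) (top_of_set {0..1}) (\<lambda>\<omega>. \<omega> ?d)"
      unfolding param_topology_def by (rule continuous_map_product_projection)
    then have "continuous_map (param_topology r s) euclideanreal (\<lambda>\<omega>. \<omega> ?d)"
      by (rule continuous_map_into_fulltopology)
    then have coord: "continuous_map data_topology euclideanreal (\<lambda>p. snd p ?d)"
      using continuous_map_compose[OF continuous_map_snd] by (fastforce simp: o_def)
    have "continuous_map data_topology
        (prod_topology euclideanreal (prod_topology euclideanreal
          (prod_topology euclideanreal (prod_topology euclideanreal euclideanreal)))) ?q"
      using Suc.IH i coord by (intro continuous_map_pairedI) auto
    \<comment> \<open>The family is continuous only on \<^term>\<open>lambda_dom c\<close>, and neighbouring grid values stay in it.\<close>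
    moreover have "?q p \<in> lambda_dom c" if "p \<in> topspace data_topology" for p
    proof -
      have "snd p ?d \<in> {0..1}"
        using topspace_data[OF that] d by (auto simp: param_topology_def PiE_iff)
      then show ?thesis
        using topspace_data[OF that] grid_val_step i(1) dyadic_pt_less_Suc[OF r_less_s]
          order_trans[OF r_nonneg dyadic_pt_ge[OF r_less_s]]
        by (simp add: lambda_dom_def)
    qed
    ultimately have "continuous_map data_topology (top_of_set (lambda_dom c)) ?q"
      by (intro continuous_map_into_subtopology) auto
    moreover have "continuous_map (top_of_set (lambda_dom c)) euclideanreal
        (\<lambda>(a, b, r, s, \<xi>). l r a s b \<xi>)"
      using family by (simp add: lambda_family_def)
    ultimately have "continuous_map data_topology euclideanreal
        ((\<lambda>(a, b, r, s, \<xi>). l r a s b \<xi>) \<circ> ?q)"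
      by (rule continuous_map_compose)
    then show ?thesis
      unfolding j grid_val_odd by (simp add: o_def)
  qed
qed

lemma bridge_joint_eq: "bridge_joint l r s p = bridge l r (fst (fst p)) s (snd (fst p)) (snd p)"
  by (simp add: bridge_joint_def split_beta)

lemma bridge_joint_in_lip_paths:
  "p \<in> topspace data_topology \<Longrightarrow> bridge_joint l r s p \<in> lip_paths c r s"
  unfolding bridge_joint_eq using topspace_data bridge_in_lip_paths by blast

text \<open>Half of the error \<open>e\<close> pays for the mesh, by taking the level large, and the other half for the
  finitely many grid values of that level, by shrinking the neighbourhood.\<close>

lemma continuous_map_bridge_joint:
  "continuous_map data_topology (path_topology r s) (bridge_joint l r s)"
proof -
  interpret P: Metric_space "mspace (path_metric r s)" "mdist (path_metric r s)"
    by (rule Metric_space_mspace_mdist)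
  have in_path: "x \<in> mspace (path_metric r s)" if "x \<in> lip_paths c r s" for x
    using that by (simp add: lip_paths_def)
  show ?thesis
    unfolding mtopology_of_def P.continuous_map_to_metric
  proof (intro ballI allI impI)
    fix p and e :: real
    assume p: "p \<in> topspace data_topology" and e: "0 < e"
    define M where "M = 2 * (c * (s - r))"
    have M: "0 < M"
      using c_pos r_less_s by (simp add: M_def)
    obtain m where "(1 / 2) ^ m < e / 2 / M"
      using real_arch_pow_inv[of "e / 2 / M" "1 / 2"] e M by auto
    then have m: "2 * (c * ((s - r) / 2 ^ m)) < e / 2"
      using M by (simp add: M_def field_simps)
    let ?g = "\<lambda>j p. grid_val l r (fst (fst p)) s (snd (fst p)) (snd p) m j"
    define N where "N j = {q \<in> topspace data_topology. ?g j q \<in> ball (?g j p) (e / 2)}" for j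
    have "openin data_topology (N j)" if "j \<in> {..2 ^ m}" for j
      unfolding N_def using that
      by (intro openin_continuous_map_preimage[OF continuous_map_grid_val]) auto
    then have "openin data_topology (\<Inter>j\<in>{..2 ^ m}. N j)"
      by (intro openin_INT2) auto
    moreover have "p \<in> (\<Inter>j\<in>{..2 ^ m}. N j)"
      using p e by (simp add: N_def)
    moreover have "bridge_joint l r s q \<in> P.mball (bridge_joint l r s p) e"
      if q: "q \<in> (\<Inter>j\<in>{..2 ^ m}. N j)" for q
    proof -
      have q': "q \<in> topspace data_topology"
        using q by (auto simp: N_def)
      have lip: "bridge_joint l r s p \<in> lip_paths c r s" "bridge_joint l r s q \<in> lip_paths c r s"
        using p q' bridge_joint_in_lip_paths by blast+
      have "mdist (path_metric r s) (bridge_joint l r s p) (bridge_joint l r s q)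
          \<le> e / 2 + 2 * (c * ((s - r) / 2 ^ m))"
      proof (rule dist_le_from_grid[OF r_less_s _ _ lip])
        fix j :: nat assume j: "j \<le> 2 ^ m"
        have "q \<in> N j"
          using q j by blast
        then show "\<bar>bridge_joint l r s p (dyadic_pt r s m j)
            - bridge_joint l r s q (dyadic_pt r s m j)\<bar> \<le> e / 2"
          using bridge_dyadic_pt[OF _ _ j] topspace_data[OF p] topspace_data[OF q']
          by (simp add: bridge_joint_eq N_def dist_real_def)
      qed (use c_pos e in auto)
      with m lip in_path show ?thesis
        by (simp add: P.in_mball)
    qed
    ultimately show "\<exists>U. openin data_topology U \<and> p \<in> U \<and>
        (\<forall>q\<in>U. bridge_joint l r s q \<in> P.mball (bridge_joint l r s p) e)"
      by blast
  qed
qed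

lemma continuous_map_bridge:
  assumes ab: "(a, b) \<in> endpoint_pairs c r s"
  shows "continuous_map (param_topology r s) (path_topology r s) (bridge l r a s b)"
proof -
  have "continuous_map (param_topology r s) data_topology (\<lambda>\<omega>. ((a, b), \<omega>))"
    using ab by (intro continuous_map_pairedI) auto
  from continuous_map_compose[OF this continuous_map_bridge_joint] show ?thesis
    by (simp add: o_def bridge_joint_def)
qed

end

theorem theorem2p5:
  fixes c r s :: real
    and l :: "real \<Rightarrow> real \<Rightarrow> real \<Rightarrow> real \<Rightarrow> real \<Rightarrow> real"
  assumes "c > 0" and "lambda_family c l" and "0 \<le> r" and "r < s"
  shows "continuous_map
           (prod_topology (top_of_set (endpoint_pairs c r s)) (param_topology r s))
           (subtopology (path_topology r s) (lip_paths c r s))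
           (bridge_joint l r s)
       \<and> (\<forall>(a, b)\<in>endpoint_pairs c r s.
            continuous_map (param_topology r s)
              (subtopology (path_topology r s) (lip_bridges c r a s b))
              (bridge l r a s b))"
proof -
  interpret bridge_family c r s l
    using assms by unfold_locales
  show ?thesis
    using continuous_map_bridge_joint bridge_joint_in_lip_paths
      continuous_map_bridge bridge_in_lip_bridges
    by (auto simp: continuous_map_in_subtopology simp del: topspace_prod_topology)
qed

end
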